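(* Let $(E,d_E)$ be a complete separable metric space with Borel $\sigma$-algebra $\mathcal E$, let $\mu,\widetilde\mu$ be probability measures on $(E,\mathcal E)$, and let $\Phi\colon E\to[0,\infty)$ be measurable. Put $Z:=\int_E e^{-\Phi}\,d\mu$, $\widetilde Z:=\int_E e^{-\Phi}\,d\widetilde\mu$ and define the probability measures $$\mu_\Phi(dx):=\frac1Z e^{-\Phi(x)}\,\mu(dx),\qquad \widetilde\mu_\Phi(dx):=\frac1{\widetilde Z}e^{-\Phi(x)}\,\widetilde\mu(dx).$$ Then $$d_{\mathrm H}(\mu_\Phi,\widetilde\mu_\Phi)\le\frac{2}{\min(Z,\widetilde Z)}\,d_{\mathrm H}(\mu,\widetilde\mu)\qquad\text{and}\qquad |Z-\widetilde Z|\le 2\,d_{\mathrm H}(\mu,\widetilde\mu).$$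
   Context: The Hellinger distance of probability measures $\mu,\widetilde\mu$ on $E$ is (without normalizing factor) given by $d_{\mathrm H}^2(\mu,\widetilde\mu):=\int_E\left(\sqrt{\frac{d\mu}{d\nu}}-\sqrt{\frac{d\widetilde\mu}{d\nu}}\right)^2 d\nu$, where $\nu$ is any measure dominating both (e.g. $\nu=\frac12\mu+\frac12\widetilde\mu$). *)

theory Defs
  imports "HOL-Probability.Probability"
begin

definition midpoint_measure :: "'a measure \<Rightarrow> 'a measure \<Rightarrow> 'a measure" where
  "midpoint_measure M N =
     measure_of (space M) (sets M) (\<lambda>A. (1/2) * emeasure M A + (1/2) * emeasure N A)"

text \<open>
  The distance is first defined relative to a reference measure \<open>R\<close>. It does not depend on
  \<open>R\<close> as long as \<open>R\<close> is sigma-finite and dominates both measures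
  (lemma \<open>hellinger_dist_eq_wrt\<close> below), so the midpoint serves as a canonical choice.
\<close>

definition hellinger_dist_wrt :: "'a measure \<Rightarrow> 'a measure \<Rightarrow> 'a measure \<Rightarrow> real" where
  "hellinger_dist_wrt R M N =
     sqrt (\<integral>x. (sqrt (enn2real (RN_deriv R M x)) - sqrt (enn2real (RN_deriv R N x)))\<^sup>2 \<partial>R)"

definition hellinger_dist :: "'a measure \<Rightarrow> 'a measure \<Rightarrow> real" where
  "hellinger_dist M N = hellinger_dist_wrt (midpoint_measure M N) M N"

definition norm_const :: "('a \<Rightarrow> real) \<Rightarrow> 'a measure \<Rightarrow> real" where
  "norm_const \<Phi> M = (\<integral>x. exp (- \<Phi> x) \<partial>M)"

definition reweight :: "('a \<Rightarrow> real) \<Rightarrow> 'a measure \<Rightarrow> 'a measure" where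
  "reweight \<Phi> M = density M (\<lambda>x. ennreal (1 / norm_const \<Phi> M * exp (- \<Phi> x)))"

lemma space_midpoint_measure [simp]: "space (midpoint_measure M N) = space M"
  by (simp add: midpoint_measure_def)

lemma sets_midpoint_measure [simp, measurable_cong]: "sets (midpoint_measure M N) = sets M"
  by (simp add: midpoint_measure_def)

lemma emeasure_midpoint_measure:
  assumes "sets N = sets M" "A \<in> sets M"
  shows "emeasure (midpoint_measure M N) A = (1/2) * emeasure M A + (1/2) * emeasure N A"
  unfolding midpoint_measure_def
proof (rule emeasure_measure_of_sigma)
  show "sigma_algebra (space M) (sets M)" ..
  show "positive (sets M) (\<lambda>A. (1/2) * emeasure M A + (1/2) * emeasure N A)"
    by (simp add: positive_def)
  show "countably_additive (sets M) (\<lambda>A. (1/2) * emeasure M A + (1/2) * emeasure N A)"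
  proof (rule countably_additiveI)
    fix F :: "nat \<Rightarrow> 'a set"
    assume F: "range F \<subseteq> sets M" "disjoint_family F" "\<Union> (range F) \<in> sets M"
    have "(\<Sum>i. (1/2) * emeasure M (F i) + (1/2) * emeasure N (F i))
        = (1/2) * (\<Sum>i. emeasure M (F i)) + (1/2) * (\<Sum>i. emeasure N (F i))"
      by (simp only: suminf_add[symmetric] ennreal_suminf_cmult summableI)
    also have "\<dots> = (1/2) * emeasure M (\<Union> (range F)) + (1/2) * emeasure N (\<Union> (range F))"
      using F assms(1) by (simp add: suminf_emeasure)
    finally show "(\<Sum>i. (1/2) * emeasure M (F i) + (1/2) * emeasure N (F i))
        = (1/2) * emeasure M (\<Union> (range F)) + (1/2) * emeasure N (\<Union> (range F))" .
  qed
  show "A \<in> sets M" by fact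
qed

lemma prob_space_midpoint_measure:
  assumes "prob_space M" "prob_space N" "sets N = sets M"
  shows "prob_space (midpoint_measure M N)"
proof (rule prob_spaceI)
  have "emeasure N (space M) = 1"
    using prob_space.emeasure_space_1[OF assms(2)] sets_eq_imp_space_eq[OF assms(3)] by simp
  moreover have "(1/2 :: ennreal) + 1/2 = 1"
  proof -
    have "(1/2 :: ennreal) = ennreal (1/2)"
      using divide_ennreal[of 1 2] by simp
    then show ?thesis
      unfolding \<open>1/2 = ennreal (1/2)\<close> by (subst ennreal_plus[symmetric]) auto
  qed
  ultimately show "emeasure (midpoint_measure M N) (space (midpoint_measure M N)) = 1"
    by (simp add: emeasure_midpoint_measure[OF assms(3)] prob_space.emeasure_space_1[OF assms(1)])
qed

lemma absolutely_continuous_midpoint_measure: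
  assumes "sets N = sets M"
  shows "absolutely_continuous (midpoint_measure M N) M"
    and "absolutely_continuous (midpoint_measure M N) N"
  unfolding absolutely_continuous_def
  using assms by (auto simp: null_sets_def emeasure_midpoint_measure ennreal_divide_eq_0_iff)

text \<open>The integral in the definition is a genuine one, not the default value 0.\<close>

lemma integrable_hellinger:
  assumes "sigma_finite_measure R" "prob_space M" "prob_space N"
    and "sets M = sets R" "sets N = sets R"
    and "absolutely_continuous R M" "absolutely_continuous R N"
  shows "integrable R
    (\<lambda>x. (sqrt (enn2real (RN_deriv R M x)) - sqrt (enn2real (RN_deriv R N x)))\<^sup>2)"
proof -
  interpret R: sigma_finite_measure R by fact
  interpret M: prob_space M by fact
  interpret N: prob_space N by fact
  have "integrable R (\<lambda>x. enn2real (RN_deriv R M x) * 1)"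
    using R.RN_deriv_integrable[OF _ assms(6,4), of "\<lambda>_. 1"] M.sigma_finite_measure_axioms by simp
  moreover have "integrable R (\<lambda>x. enn2real (RN_deriv R N x) * 1)"
    using R.RN_deriv_integrable[OF _ assms(7,5), of "\<lambda>_. 1"] N.sigma_finite_measure_axioms by simp
  ultimately have "integrable R (\<lambda>x. enn2real (RN_deriv R M x) + enn2real (RN_deriv R N x))"
    by simp
  then show ?thesis
  proof (rule Bochner_Integration.integrable_bound)
    show "AE x in R. norm ((sqrt (enn2real (RN_deriv R M x)) - sqrt (enn2real (RN_deriv R N x)))\<^sup>2)
        \<le> norm (enn2real (RN_deriv R M x) + enn2real (RN_deriv R N x))"
    proof (rule AE_I2)
      fix x
      have "(a - b)\<^sup>2 \<le> a\<^sup>2 + b\<^sup>2" if "0 \<le> a" "0 \<le> b" for a b :: real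
        using that by (simp add: power2_diff)
      from this[of "sqrt (enn2real (RN_deriv R M x))" "sqrt (enn2real (RN_deriv R N x))"]
      show "norm ((sqrt (enn2real (RN_deriv R M x)) - sqrt (enn2real (RN_deriv R N x)))\<^sup>2)
        \<le> norm (enn2real (RN_deriv R M x) + enn2real (RN_deriv R N x))"
        by simp
    qed
  qed measurable
qed

lemma hellinger_dist_eq_wrt:
  assumes "sigma_finite_measure R" "prob_space M" "prob_space N"
    and sets: "sets M = sets R" "sets N = sets R"
    and ac: "absolutely_continuous R M" "absolutely_continuous R N"
  shows "hellinger_dist M N = hellinger_dist_wrt R M N"
proof -
  interpret R: sigma_finite_measure R by fact
  have sMN: "sets N = sets M" using sets by simp
  define L where "L = midpoint_measure M N"
  interpret L: prob_space L
    unfolding L_def by (rule prob_space_midpoint_measure) (use assms sMN in auto)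
  have sL: "sets L = sets R" by (simp add: L_def sets)
  have acL: "absolutely_continuous R L"
    using ac sets unfolding absolutely_continuous_def L_def
    by (auto simp: null_sets_def emeasure_midpoint_measure[OF sMN] subset_iff)
  have mL: "borel_measurable L = borel_measurable R"
    by (rule measurable_cong_sets) (auto simp: sL)
  have chain: "AE x in R. RN_deriv R L x * RN_deriv L K x = RN_deriv R K x"
    if "sets K = sets R" "absolutely_continuous L K" for K
  proof (rule R.RN_deriv_unique)
    have m: "RN_deriv L K \<in> borel_measurable R"
      using borel_measurable_RN_deriv[of L K] unfolding mL .
    then show "(\<lambda>x. RN_deriv R L x * RN_deriv L K x) \<in> borel_measurable R" by measurable
    have "density R (\<lambda>x. RN_deriv R L x * RN_deriv L K x)
        = density (density R (RN_deriv R L)) (RN_deriv L K)"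
      using m by (simp add: density_density_eq)
    also have "\<dots> = K"
      using that sL by (simp add: R.density_RN_deriv[OF acL sL] L.density_RN_deriv)
    finally show "density R (\<lambda>x. RN_deriv R L x * RN_deriv L K x) = K" .
  qed
  note cM = chain[OF sets(1) absolutely_continuous_midpoint_measure(1)[OF sMN, folded L_def]]
  note cN = chain[OF sets(2) absolutely_continuous_midpoint_measure(2)[OF sMN, folded L_def]]
  have m [measurable]: "RN_deriv L M \<in> borel_measurable R" "RN_deriv L N \<in> borel_measurable R"
    using borel_measurable_RN_deriv[of L M] borel_measurable_RN_deriv[of L N] unfolding mL .
  have "(\<integral>x. (sqrt (enn2real (RN_deriv L M x)) - sqrt (enn2real (RN_deriv L N x)))\<^sup>2 \<partial>L)
     = (\<integral>x. enn2real (RN_deriv R L x) *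
          (sqrt (enn2real (RN_deriv L M x)) - sqrt (enn2real (RN_deriv L N x)))\<^sup>2 \<partial>R)"
    by (rule R.RN_deriv_integral[OF _ acL sL]) (unfold_locales, measurable)
  also have "\<dots> = (\<integral>x. (sqrt (enn2real (RN_deriv R M x)) - sqrt (enn2real (RN_deriv R N x)))\<^sup>2 \<partial>R)"
  proof (rule integral_cong_AE)
    show "AE x in R. enn2real (RN_deriv R L x) *
          (sqrt (enn2real (RN_deriv L M x)) - sqrt (enn2real (RN_deriv L N x)))\<^sup>2
        = (sqrt (enn2real (RN_deriv R M x)) - sqrt (enn2real (RN_deriv R N x)))\<^sup>2"
      using cM cN
    proof eventually_elim
      case (elim x)
      show ?case
        unfolding elim[symmetric] enn2real_mult real_sqrt_mult right_diff_distrib[symmetric]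
        by (simp add: power_mult_distrib)
    qed
  qed measurable
  finally show ?thesis
    unfolding hellinger_dist_def hellinger_dist_wrt_def L_def[symmetric] by simp
qed

lemma norm_const_pos:
  assumes "prob_space M" "\<Phi> \<in> borel_measurable M" "\<And>x. 0 \<le> \<Phi> x"
  shows "0 < norm_const \<Phi> M"
proof -
  interpret prob_space M by fact
  have "integrable M (\<lambda>x. exp (- \<Phi> x))"
    by (rule integrable_const_bound[where B = 1]) (use assms in auto)
  then show ?thesis
    unfolding norm_const_def
    using integral_less_AE_space[of "\<lambda>_. 0" "\<lambda>x. exp (- \<Phi> x)"] emeasure_space_1 by simp
qed

lemma prob_space_reweight:
  assumes "prob_space M" "\<Phi> \<in> borel_measurable M" "\<And>x. 0 \<le> \<Phi> x"
  shows "prob_space (reweight \<Phi> M)"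
proof (rule prob_spaceI)
  interpret prob_space M by fact
  have int: "integrable M (\<lambda>x. exp (- \<Phi> x))"
    by (rule integrable_const_bound[where B = 1]) (use assms in auto)
  have pos: "0 < norm_const \<Phi> M" by (rule norm_const_pos) fact+
  have "emeasure (reweight \<Phi> M) (space (reweight \<Phi> M))
      = (\<integral>\<^sup>+x. ennreal (1 / norm_const \<Phi> M * exp (- \<Phi> x)) \<partial>M)"
    using assms(2) by (simp add: reweight_def emeasure_density cong: nn_integral_cong)
  also have "\<dots> = ennreal (\<integral>x. 1 / norm_const \<Phi> M * exp (- \<Phi> x) \<partial>M)"
    by (rule nn_integral_eq_integral) (use int pos in auto)
  also have "(\<integral>x. 1 / norm_const \<Phi> M * exp (- \<Phi> x) \<partial>M) = 1"
    using pos by (subst integral_mult_right_zero) (simp add: norm_const_def)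
  finally show "emeasure (reweight \<Phi> M) (space (reweight \<Phi> M)) = 1" by simp
qed

end

(* Both claims are statements about the vectors p = sqrt f and q = sqrt g in L2(R), where f and g
   are densities of the two measures with respect to a common reference measure R.
   As |f - g| = |p - q| (p + q) and both p and q have norm 1, the Cauchy-Schwarz inequality gives
   |Z - Z'| <= 2 d. Reweighting replaces p and q by the normalizations of u = exp(-Phi/2) p and
   v = exp(-Phi/2) q, which have norms sqrt Z and sqrt Z'. In a Hilbert space
     |u|*|v| * norm (u/|u| - v/|v|)^2 <= norm (u - v)^2,
   so the distance grows at most by the factor 1 / sqrt (min Z Z'), and min Z Z' <= 1. *)
theory Submission
  imports Defs
begin

section \<open>Inequalities for square-integrable real functions\<close>

lemma integrable_mult_of_squares:
  fixes u v :: "'a \<Rightarrow> real"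
  assumes [measurable]: "u \<in> borel_measurable M" "v \<in> borel_measurable M"
    and "integrable M (\<lambda>x. (u x)\<^sup>2)" "integrable M (\<lambda>x. (v x)\<^sup>2)"
  shows "integrable M (\<lambda>x. u x * v x)"
proof (rule Bochner_Integration.integrable_bound)
  show "integrable M (\<lambda>x. (u x)\<^sup>2 + (v x)\<^sup>2)" using assms by simp
  have "\<bar>a * b\<bar> \<le> a\<^sup>2 + b\<^sup>2" for a b :: real
  proof -
    have "0 \<le> (\<bar>a\<bar> - \<bar>b\<bar>)\<^sup>2" by simp
    then have "2 * \<bar>a * b\<bar> \<le> a\<^sup>2 + b\<^sup>2" by (simp add: power2_diff abs_mult)
    then show ?thesis using abs_ge_zero[of "a * b"] by linarith
  qed
  then show "AE x in M. norm (u x * v x) \<le> norm ((u x)\<^sup>2 + (v x)\<^sup>2)"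
    by (intro AE_I2) simp
qed measurable

text \<open>Follows from the inequality for nonnegative extended integrals: the squares and the
  product are integrable, so all three integrals are finite and the inequality can be read in the
  reals before roots are taken.\<close>

lemma Cauchy_Schwarz_integral:
  fixes u v :: "'a \<Rightarrow> real"
  assumes [measurable]: "u \<in> borel_measurable M" "v \<in> borel_measurable M"
    and int: "integrable M (\<lambda>x. (u x)\<^sup>2)" "integrable M (\<lambda>x. (v x)\<^sup>2)"
  shows "(\<integral>x. \<bar>u x * v x\<bar> \<partial>M) \<le> sqrt (\<integral>x. (u x)\<^sup>2 \<partial>M) * sqrt (\<integral>x. (v x)\<^sup>2 \<partial>M)"
proof -
  have uv: "integrable M (\<lambda>x. \<bar>u x * v x\<bar>)"
    using integrable_mult_of_squares[OF assms] by simp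
  have "(\<integral>\<^sup>+x. ennreal \<bar>u x\<bar> * ennreal \<bar>v x\<bar> \<partial>M)\<^sup>2
      \<le> (\<integral>\<^sup>+x. (ennreal \<bar>u x\<bar>)\<^sup>2 \<partial>M) * (\<integral>\<^sup>+x. (ennreal \<bar>v x\<bar>)\<^sup>2 \<partial>M)"
    by (rule Cauchy_Schwarz_nn_integral) measurable
  also have "(\<integral>\<^sup>+x. ennreal \<bar>u x\<bar> * ennreal \<bar>v x\<bar> \<partial>M) = ennreal (\<integral>x. \<bar>u x * v x\<bar> \<partial>M)"
    using uv by (simp add: nn_integral_eq_integral flip: ennreal_mult abs_mult)
  also have "(\<integral>\<^sup>+x. (ennreal \<bar>u x\<bar>)\<^sup>2 \<partial>M) = ennreal (\<integral>x. (u x)\<^sup>2 \<partial>M)"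
    using int by (simp add: ennreal_power nn_integral_eq_integral)
  also have "(\<integral>\<^sup>+x. (ennreal \<bar>v x\<bar>)\<^sup>2 \<partial>M) = ennreal (\<integral>x. (v x)\<^sup>2 \<partial>M)"
    using int by (simp add: ennreal_power nn_integral_eq_integral)
  finally have "(\<integral>x. \<bar>u x * v x\<bar> \<partial>M)\<^sup>2 \<le> (\<integral>x. (u x)\<^sup>2 \<partial>M) * (\<integral>x. (v x)\<^sup>2 \<partial>M)"
    by (simp add: ennreal_power flip: ennreal_mult)
  then have "sqrt ((\<integral>x. \<bar>u x * v x\<bar> \<partial>M)\<^sup>2) \<le> sqrt ((\<integral>x. (u x)\<^sup>2 \<partial>M) * (\<integral>x. (v x)\<^sup>2 \<partial>M))"
    by (rule real_sqrt_le_mono)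
  then show ?thesis by (simp add: real_sqrt_mult)
qed

text \<open>With \<open>c\<close> the inner product of \<open>u\<close> and \<open>v\<close>, the
  left side expands to \<open>2 * a * b - 2 * c\<close> and the right side to
  \<open>a\<^sup>2 + b\<^sup>2 - 2 * c\<close>. The inner product cancels, and what remains is that
  \<open>(a - b)\<^sup>2\<close> is nonnegative.\<close>

lemma integral_diff_normalized_le:
  fixes u v :: "'a \<Rightarrow> real"
  assumes [measurable]: "u \<in> borel_measurable M" "v \<in> borel_measurable M"
    and int: "integrable M (\<lambda>x. (u x)\<^sup>2)" "integrable M (\<lambda>x. (v x)\<^sup>2)"
    and a: "a > 0" "(\<integral>x. (u x)\<^sup>2 \<partial>M) = a\<^sup>2"
    and b: "b > 0" "(\<integral>x. (v x)\<^sup>2 \<partial>M) = b\<^sup>2"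
  shows "a * b * (\<integral>x. (u x / a - v x / b)\<^sup>2 \<partial>M) \<le> (\<integral>x. (u x - v x)\<^sup>2 \<partial>M)"
proof -
  define c where "c = (\<integral>x. u x * v x \<partial>M)"
  note uv = integrable_mult_of_squares[OF assms(1-4)]
  \<comment> \<open>General coefficients let one expansion cover both sides: \<open>1/a, 1/b\<close>
    for the normalized vectors and \<open>1, 1\<close> for the original ones.\<close>
  have expand: "(\<integral>x. (s * u x - t * v x)\<^sup>2 \<partial>M) = s\<^sup>2 * a\<^sup>2 + t\<^sup>2 * b\<^sup>2 - 2 * s * t * c" for s t
  proof -
    have "(\<lambda>x. (s * u x - t * v x)\<^sup>2)
        = (\<lambda>x. s\<^sup>2 * (u x)\<^sup>2 + t\<^sup>2 * (v x)\<^sup>2 - (2 * s * t) * (u x * v x))"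
      by (simp add: fun_eq_iff power2_diff power_mult_distrib)
    then show ?thesis
      using int uv a b by (simp add: c_def)
  qed
  have "(\<integral>x. (u x / a - v x / b)\<^sup>2 \<partial>M) = 2 - 2 * c / (a * b)"
    using expand[of "1/a" "1/b"] a(1) b(1) by (simp add: power_divide)
  then have "a * b * (\<integral>x. (u x / a - v x / b)\<^sup>2 \<partial>M) = 2 * a * b - 2 * c"
    using a(1) b(1) by (simp add: field_simps)
  also have "\<dots> \<le> a\<^sup>2 + b\<^sup>2 - 2 * c"
    using sum_squares_bound[of a b] by simp
  also have "\<dots> = (\<integral>x. (u x - v x)\<^sup>2 \<partial>M)"
    using expand[of 1 1] by simp
  finally show ?thesis .
qed

section \<open>Hellinger distance and reweighting in terms of densities\<close>

lemma prob_space_density_real: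
  fixes f :: "'a \<Rightarrow> real"
  assumes "prob_space (density R f)" and [measurable]: "f \<in> borel_measurable R"
    and nn: "\<And>x. 0 \<le> f x"
  shows "integrable R f" and "(\<integral>x. f x \<partial>R) = 1"
proof -
  have "(\<integral>\<^sup>+x. ennreal (f x) \<partial>R) = emeasure (density R f) (space (density R f))"
    by (simp add: emeasure_density cong: nn_integral_cong)
  also have "\<dots> = ennreal 1"
    using prob_space.emeasure_space_1[OF assms(1)] by simp
  finally have "integrable R f \<and> (\<integral>x. f x \<partial>R) = 1"
    using nn_integral_eq_integrable[of f R 1] nn by simp
  then show "integrable R f" "(\<integral>x. f x \<partial>R) = 1" by simp_all
qed

text \<open>Replaces the Radon-Nikodym derivatives by given densities. The distance may be computed
  relative to \<open>R\<close> because \<open>R\<close> dominates every measure with a density, and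
  by uniqueness the derivatives agree with \<open>f\<close> and \<open>g\<close> almost everywhere,
  which the integral does not notice.\<close>

lemma hellinger_dist_density:
  fixes f g :: "'a \<Rightarrow> real"
  assumes "sigma_finite_measure R" "prob_space (density R f)" "prob_space (density R g)"
    and [measurable]: "f \<in> borel_measurable R" "g \<in> borel_measurable R"
    and nn: "\<And>x. 0 \<le> f x" "\<And>x. 0 \<le> g x"
  shows "hellinger_dist (density R f) (density R g) = sqrt (\<integral>x. (sqrt (f x) - sqrt (g x))\<^sup>2 \<partial>R)"
proof -
  interpret sigma_finite_measure R by fact
  have "hellinger_dist (density R f) (density R g) = hellinger_dist_wrt R (density R f) (density R g)"
    using assms(1-3) by (intro hellinger_dist_eq_wrt) (auto intro!: absolutely_continuousI_density)
  moreover have "AE x in R. ennreal (f x) = RN_deriv R (density R f) x"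
    and "AE x in R. ennreal (g x) = RN_deriv R (density R g) x"
    by (rule RN_deriv_unique; simp)+
  then have "AE x in R. (sqrt (enn2real (RN_deriv R (density R f) x))
                         - sqrt (enn2real (RN_deriv R (density R g) x)))\<^sup>2
                      = (sqrt (f x) - sqrt (g x))\<^sup>2"
    by eventually_elim (metis nn enn2real_ennreal)
  then have "(\<integral>x. (sqrt (enn2real (RN_deriv R (density R f) x))
                  - sqrt (enn2real (RN_deriv R (density R g) x)))\<^sup>2 \<partial>R)
      = (\<integral>x. (sqrt (f x) - sqrt (g x))\<^sup>2 \<partial>R)"
    by (intro integral_cong_AE) measurable
  ultimately show ?thesis
    by (simp add: hellinger_dist_wrt_def)
qed

lemma norm_const_density:
  fixes f :: "'a \<Rightarrow> real"
  assumes "f \<in> borel_measurable R" "\<And>x. 0 \<le> f x" "\<Phi> \<in> borel_measurable R"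
  shows "norm_const \<Phi> (density R f) = (\<integral>x. f x * exp (- \<Phi> x) \<partial>R)"
  unfolding norm_const_def using assms by (subst integral_density) auto

lemma reweight_density:
  fixes f :: "'a \<Rightarrow> real"
  assumes [measurable]: "f \<in> borel_measurable R" "\<Phi> \<in> borel_measurable R"
    and "\<And>x. 0 \<le> f x" and "0 < norm_const \<Phi> (density R f)"
  shows "reweight \<Phi> (density R f)
    = density R (\<lambda>x. f x * exp (- \<Phi> x) / norm_const \<Phi> (density R f))"
  unfolding reweight_def using assms(3,4)
  by (subst density_density_eq) (auto intro!: density_cong simp flip: ennreal_mult)

section \<open>The two estimates for measures given by densities\<close>

lemma norm_const_le_1:
  assumes "prob_space M" "\<And>x. 0 \<le> \<Phi> x"
  shows "norm_const \<Phi> M \<le> 1"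
proof -
  interpret prob_space M by fact
  show ?thesis
  proof (cases "integrable M (\<lambda>x. exp (- \<Phi> x))")
    case True
    then show ?thesis
      unfolding norm_const_def using assms(2) by (intro integral_le_const AE_I2) auto
  \<comment> \<open>Without integrability the integral has the default value 0, which also satisfies
    the bound.\<close>
  qed (simp add: norm_const_def not_integrable_integral_eq)
qed

text \<open>With both measures given by real densities over one \<open>R\<close>, the distances and
  normalizing constants become integrals over \<open>R\<close>, and the L2 inequalities apply to the
  roots of the densities.\<close>

lemma hellinger_dist_reweight_density:
  fixes f g \<Phi> :: "'a \<Rightarrow> real" and R :: "'a measure"
  defines "M \<equiv> density R f" and "N \<equiv> density R g"
  assumes R: "sigma_finite_measure R" and M: "prob_space M" and N: "prob_space N"
    and meas [measurable]: "f \<in> borel_measurable R" "g \<in> borel_measurable R" "\<Phi> \<in> borel_measurable R"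
    and nn: "\<And>x. 0 \<le> f x" "\<And>x. 0 \<le> g x" "\<And>x. 0 \<le> \<Phi> x"
  shows "hellinger_dist (reweight \<Phi> M) (reweight \<Phi> N)
      \<le> 2 / min (norm_const \<Phi> M) (norm_const \<Phi> N) * hellinger_dist M N"
    and "\<bar>norm_const \<Phi> M - norm_const \<Phi> N\<bar> \<le> 2 * hellinger_dist M N"
proof -
  note f = prob_space_density_real[OF M[unfolded M_def] meas(1) nn(1)]
  note g = prob_space_density_real[OF N[unfolded N_def] meas(2) nn(2)]
  define d where "d = hellinger_dist M N"
  have d: "d = sqrt (\<integral>x. (sqrt (f x) - sqrt (g x))\<^sup>2 \<partial>R)"
    unfolding d_def M_def N_def using assms by (intro hellinger_dist_density) auto
  have d0: "0 \<le> d" unfolding d by simp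
  \<comment> \<open>The weight takes values in (0, 1], so multiplying a nonnegative integrand by it
    cannot increase the integral. This is how it drops out of both estimates.\<close>
  define h where "h = (\<lambda>x. exp (- \<Phi> x))"
  have [measurable]: "h \<in> borel_measurable R" unfolding h_def by measurable
  have h: "0 < h x" "h x \<le> 1" for x using nn(3)[of x] by (auto simp: h_def)
  have fh: "integrable R (\<lambda>x. f x * h x)"
    by (rule Bochner_Integration.integrable_bound[OF f(1)])
       (use nn h in \<open>auto simp: abs_mult less_imp_le intro!: mult_left_le\<close>)
  have gh: "integrable R (\<lambda>x. g x * h x)"
    by (rule Bochner_Integration.integrable_bound[OF g(1)])
       (use nn h in \<open>auto simp: abs_mult less_imp_le intro!: mult_left_le\<close>)
  have diff_square: "integrable R (\<lambda>x. (sqrt (f x) - sqrt (g x))\<^sup>2)"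
    and sum_square: "integrable R (\<lambda>x. (sqrt (f x) + sqrt (g x))\<^sup>2)"
  proof -
    have *: "integrable R (\<lambda>x. sqrt (f x) * sqrt (g x))"
      by (rule integrable_mult_of_squares) (use f g nn in auto)
    show "integrable R (\<lambda>x. (sqrt (f x) - sqrt (g x))\<^sup>2)"
      using * f g nn by (simp add: power2_diff mult.assoc)
    show "integrable R (\<lambda>x. (sqrt (f x) + sqrt (g x))\<^sup>2)"
      using * f g nn by (simp add: power2_sum mult.assoc)
  qed
  define Z where "Z = norm_const \<Phi> M"
  define Z' where "Z' = norm_const \<Phi> N"
  have Z: "Z = (\<integral>x. f x * h x \<partial>R)" and Z': "Z' = (\<integral>x. g x * h x \<partial>R)"
    unfolding Z_def Z'_def M_def N_def h_def using nn by (auto intro!: norm_const_density)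
  have Z_pos: "0 < Z" and Z'_pos: "0 < Z'"
    unfolding Z_def Z'_def using M N nn by (auto intro!: norm_const_pos simp: M_def N_def)

  have "\<bar>Z - Z'\<bar> = \<bar>\<integral>x. f x * h x - g x * h x \<partial>R\<bar>"
    unfolding Z Z' using fh gh by simp
  also have "\<dots> \<le> (\<integral>x. \<bar>f x * h x - g x * h x\<bar> \<partial>R)"
    by (rule integral_abs_bound)
  also have "\<dots> \<le> (\<integral>x. \<bar>(sqrt (f x) - sqrt (g x)) * (sqrt (f x) + sqrt (g x))\<bar> \<partial>R)"
  proof (rule integral_mono)
    show "integrable R (\<lambda>x. \<bar>(sqrt (f x) - sqrt (g x)) * (sqrt (f x) + sqrt (g x))\<bar>)"
      using integrable_mult_of_squares[OF _ _ diff_square sum_square] by simp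
    fix x
    have "(sqrt (f x) - sqrt (g x)) * (sqrt (f x) + sqrt (g x)) = f x - g x"
      using nn by (simp add: algebra_simps)
    moreover have "\<bar>f x * h x - g x * h x\<bar> = \<bar>f x - g x\<bar> * h x"
      using h[of x] by (simp add: abs_mult flip: left_diff_distrib)
    ultimately show "\<bar>f x * h x - g x * h x\<bar>
        \<le> \<bar>(sqrt (f x) - sqrt (g x)) * (sqrt (f x) + sqrt (g x))\<bar>"
      using h[of x] by (simp add: mult_left_le)
  qed (use fh gh in simp)
  also have "\<dots> \<le> d * sqrt (\<integral>x. (sqrt (f x) + sqrt (g x))\<^sup>2 \<partial>R)"
    unfolding d by (rule Cauchy_Schwarz_integral) (use diff_square sum_square in auto)
  \<comment> \<open>The constant 2 is the root of 4: the square of the sum is at most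
    \<open>2 * f x + 2 * g x\<close>, and both densities have integral 1.\<close>
  also have "sqrt (\<integral>x. (sqrt (f x) + sqrt (g x))\<^sup>2 \<partial>R) \<le> 2"
  proof -
    have "(\<integral>x. (sqrt (f x) + sqrt (g x))\<^sup>2 \<partial>R) \<le> (\<integral>x. 2 * f x + 2 * g x \<partial>R)"
    proof (rule integral_mono)
      fix x
      show "(sqrt (f x) + sqrt (g x))\<^sup>2 \<le> 2 * f x + 2 * g x"
        using sum_squares_bound[of "sqrt (f x)" "sqrt (g x)"] nn by (simp add: power2_sum)
    qed (use sum_square f g in auto)
    also have "\<dots> = 4" using f g by simp
    finally show ?thesis by (simp add: real_le_lsqrt)
  qed
  then have "d * sqrt (\<integral>x. (sqrt (f x) + sqrt (g x))\<^sup>2 \<partial>R) \<le> d * 2"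
    using d0 by (rule mult_left_mono)
  finally show "\<bar>norm_const \<Phi> M - norm_const \<Phi> N\<bar> \<le> 2 * hellinger_dist M N"
    by (simp add: Z_def Z'_def d_def)

  define D where "D = hellinger_dist (reweight \<Phi> M) (reweight \<Phi> N)"
  define m where "m = min Z Z'"
  have m: "0 < m" "m \<le> 1" "m \<le> Z" "m \<le> Z'"
    using Z_pos Z'_pos norm_const_le_1[OF M, of \<Phi>] nn by (auto simp: m_def Z_def)
  have rw: "reweight \<Phi> M = density R (\<lambda>x. f x * h x / Z)"
    "reweight \<Phi> N = density R (\<lambda>x. g x * h x / Z')"
    unfolding Z_def Z'_def M_def N_def h_def
    using nn Z_pos Z'_pos by (auto intro!: reweight_density simp: Z_def Z'_def M_def N_def)
  have "prob_space (reweight \<Phi> M)" "prob_space (reweight \<Phi> N)"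
    using M N nn by (auto intro!: prob_space_reweight simp: M_def N_def)
  then have D: "D = sqrt (\<integral>x. (sqrt (f x * h x / Z) - sqrt (g x * h x / Z'))\<^sup>2 \<partial>R)"
    unfolding D_def rw using R nn h Z_pos Z'_pos
    by (intro hellinger_dist_density) (auto simp: less_imp_le)
  \<comment> \<open>Dividing by \<open>sqrt Z\<close> and \<open>sqrt Z'\<close> normalizes the
    vectors \<open>sqrt (f x * h x)\<close> and \<open>sqrt (g x * h x)\<close>, whose squared norms
    are \<open>Z\<close> and \<open>Z'\<close>. The factor \<open>m\<close> is then enlarged to the
    product of the two norms, as \<open>integral_diff_normalized_le\<close> requires.\<close>
  have "m * D\<^sup>2 = m * (\<integral>x. (sqrt (f x * h x) / sqrt Z - sqrt (g x * h x) / sqrt Z')\<^sup>2 \<partial>R)"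
    unfolding D by (simp add: real_sqrt_divide)
  also have "\<dots> \<le> sqrt Z * sqrt Z' *
      (\<integral>x. (sqrt (f x * h x) / sqrt Z - sqrt (g x * h x) / sqrt Z')\<^sup>2 \<partial>R)"
  proof (rule mult_right_mono)
    have "sqrt m * sqrt m \<le> sqrt Z * sqrt Z'"
      using m by (intro mult_mono) auto
    then show "m \<le> sqrt Z * sqrt Z'" using m by simp
  qed simp
  also have "\<dots> \<le> (\<integral>x. (sqrt (f x * h x) - sqrt (g x * h x))\<^sup>2 \<partial>R)"
    by (rule integral_diff_normalized_le)
       (use nn h Z_pos Z'_pos fh gh Z Z' in \<open>auto simp: less_imp_le\<close>)
  \<comment> \<open>The common factor \<open>sqrt (h x)\<close> comes out of the difference, and its
    square is at most 1.\<close>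
  also have "\<dots> \<le> (\<integral>x. (sqrt (f x) - sqrt (g x))\<^sup>2 \<partial>R)"
  proof (rule integral_mono')
    fix x
    have "(sqrt (f x * h x) - sqrt (g x * h x))\<^sup>2 = (sqrt (f x) - sqrt (g x))\<^sup>2 * h x"
      using h[of x] by (simp add: real_sqrt_mult power_mult_distrib flip: left_diff_distrib)
    then show "(sqrt (f x * h x) - sqrt (g x * h x))\<^sup>2 \<le> (sqrt (f x) - sqrt (g x))\<^sup>2"
      using h[of x] by (simp add: mult_left_le)
  qed (use diff_square in auto)
  also have "\<dots> = d\<^sup>2" by (simp add: d)
  finally have "m * D\<^sup>2 \<le> d\<^sup>2" .
  \<comment> \<open>The bound so far amounts to \<open>D \<le> d / sqrt m\<close>. Since
    \<open>m \<le> 1\<close>, it can be weakened to one with \<open>m\<close> in place of its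
    root.\<close>
  moreover have "(m * D)\<^sup>2 \<le> m * D\<^sup>2"
  proof -
    have "m\<^sup>2 \<le> m" using m by (simp add: power2_eq_square mult_left_le)
    then have "m\<^sup>2 * D\<^sup>2 \<le> m * D\<^sup>2" by (rule mult_right_mono) simp
    then show ?thesis by (simp only: power_mult_distrib)
  qed
  ultimately have "(m * D)\<^sup>2 \<le> d\<^sup>2" by (rule order_trans[rotated])
  then have "m * D \<le> d" using d0 by (rule power2_le_imp_le)
  \<comment> \<open>The factor 2 of the claim enters only here, by
    \<open>d \<le> 2 * d\<close>.\<close>
  then have "D * m \<le> 2 * d" using d0 by (simp add: mult.commute)
  then have "D \<le> 2 * d / m" using m(1) by (simp only: pos_le_divide_eq)
  then have "D \<le> 2 / m * d" by simp
  then show "hellinger_dist (reweight \<Phi> M) (reweight \<Phi> N)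
      \<le> 2 / min (norm_const \<Phi> M) (norm_const \<Phi> N) * hellinger_dist M N"
    by (simp add: D_def m_def Z_def Z'_def d_def)
qed

section \<open>From absolutely continuous measures to real densities\<close>

lemma (in sigma_finite_measure) real_density_of_absolutely_continuous:
  assumes "finite_measure N" "absolutely_continuous M N" "sets N = sets M"
  obtains f :: "'a \<Rightarrow> real"
  where "f \<in> borel_measurable M" "\<And>x. 0 \<le> f x" "N = density M f"
proof -
  \<comment> \<open>\<open>RN_deriv\<close> takes extended values. Finiteness of \<open>N\<close>
    yields a real version, chosen nonnegative at every point, as the pointwise hypotheses of the
    density lemmas demand.\<close>
  obtain f where f: "f \<in> borel_measurable M" "AE x in M. RN_deriv M N x = ennreal (f x)"
    "\<And>x. 0 \<le> f x"
    using real_RN_deriv[OF assms] by metis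
  have "N = density M (RN_deriv M N)"
    using density_RN_deriv[OF assms(2,3)] by simp
  also have "\<dots> = density M f"
    using f by (intro density_cong) auto
  finally show ?thesis using that f by blast
qed

theorem theorem7:
  fixes \<mu> \<mu>' :: "'a::polish_space measure" and \<Phi> :: "'a \<Rightarrow> real"
  assumes "prob_space \<mu>" and "sets \<mu> = sets borel"
    and "prob_space \<mu>'" and "sets \<mu>' = sets borel"
    and "\<Phi> \<in> borel_measurable borel" and "\<And>x. 0 \<le> \<Phi> x"
  shows "hellinger_dist (reweight \<Phi> \<mu>) (reweight \<Phi> \<mu>')
           \<le> 2 / min (norm_const \<Phi> \<mu>) (norm_const \<Phi> \<mu>') * hellinger_dist \<mu> \<mu>'
       \<and> \<bar>norm_const \<Phi> \<mu> - norm_const \<Phi> \<mu>'\<bar> \<le> 2 * hellinger_dist \<mu> \<mu>'"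
proof -
  \<comment> \<open>The midpoint dominates both measures and is itself a probability measure, hence
    sigma-finite, so both measures have densities with respect to it.\<close>
  define R where "R = midpoint_measure \<mu> \<mu>'"
  have sets: "sets \<mu>' = sets \<mu>" "sets R = sets borel"
    using assms by (simp_all add: R_def)
  interpret R: prob_space R
    unfolding R_def using assms(1,3) sets by (intro prob_space_midpoint_measure)
  note ac = absolutely_continuous_midpoint_measure[OF sets(1), folded R_def]
  obtain f where f: "f \<in> borel_measurable R" "\<And>x. 0 \<le> f x" "\<mu> = density R (\<lambda>x. ennreal (f x))"
    using R.real_density_of_absolutely_continuous[OF prob_space.finite_measure[OF assms(1)] ac(1)] assms(2) sets
    by metis
  obtain g where g: "g \<in> borel_measurable R" "\<And>x. 0 \<le> g x" "\<mu>' = density R (\<lambda>x. ennreal (g x))"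
    using R.real_density_of_absolutely_continuous[OF prob_space.finite_measure[OF assms(3)] ac(2)] assms(4) sets
    by metis
  have "\<Phi> \<in> borel_measurable R"
    using assms(5) measurable_cong_sets[OF sets(2) refl] by blast
  from hellinger_dist_reweight_density
    [OF R.sigma_finite_measure_axioms _ _ f(1) g(1) this f(2) g(2) assms(6)]
  show ?thesis
    using assms(1,3) unfolding f(3)[symmetric] g(3)[symmetric] by blast
qed

end
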